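(* Let $\mathcal{A}$ be a finite or countably infinite linearly ordered alphabet and $X$ a probability law on $\mathcal{A}$. For $n \geqslant 1$, let $w$ be a random word of length $n$ whose letters are independent and identically distributed with law $X$, and let $\gamma_1$ be the (unique) constant for which there exists a sequence $(\varepsilon_n)$ tending to $0$ with $\mathbb{P}\left[\left||\mathsf{is}(w)|/|w| - \gamma_1\right| \geqslant \varepsilon_{|w|}\right] \leqslant \varepsilon_{|w|}$ for all $n$. Then $\gamma_1 \leqslant 1/3$.
   Context: Words are indexed from $0$: $w = w_0 \cdots w_{|w|-1}$, and $w_{i \cdots j} = w_i \cdots w_j$. A sentinel letter $\$ \notin \mathcal{A}$ is smaller than every letter of $\mathcal{A}$, and $w_{|w|} = \$$. An integer $i \leqslant |w|-1$ is $w$-non-decreasing if there is $j$ with $i+1 \leqslant j \leqslant |w|-1$ and $w_i = \cdots = w_{j-1} < w_j$; it is $w$-locally minimal if moreover $i \geqslant 1$ and $w_{i-1} > w_i$. If $i_0 < \cdots < i_{k-1}$ are the $w$-locally minimal integers and $i_k = |w|$, the unimodal factors of $w$ are $w_{i_0 \cdots i_1}, \ldots, w_{i_{k-1} \cdots i_k}$; $\mathsf{eis}(w)$ is the length-$k$ word whose letters are these factors in order, ordered lexicographically; $\mathsf{is}(w)$ is obtained from $\mathsf{eis}(w)$ by replacing each letter by its rank (from $0$) among the distinct letters of $\mathsf{eis}(w)$. In particular $|\mathsf{is}(w)|$ equals the number of $w$-locally minimal integers. (Such a constant $\gamma_1$ exists.) *)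

theory Defs
  imports "HOL-Probability.Probability" "HOL-Library.Option_ord" "HOL-Library.List_Lexorder"
begin

text \<open>
  The sentinel letter is represented by \<^term>\<open>None\<close>: in the order of
  \<^theory>\<open>HOL-Library.Option_ord\<close> it lies below every \<^term>\<open>Some a\<close>.
  Only the value at index \<^term>\<open>length w\<close> is ever used beyond the word itself.
\<close>

definition letter :: "'a list \<Rightarrow> nat \<Rightarrow> 'a option" where
  "letter w i = (if i < length w then Some (w ! i) else None)"

definition non_decreasing_at :: "'a::linorder list \<Rightarrow> nat \<Rightarrow> bool" where
  "non_decreasing_at w i \<longleftrightarrow>
     (\<exists>j. i + 1 \<le> j \<and> j < length w \<and> (\<forall>m\<in>{i..<j}. w ! m = w ! i) \<and> w ! (j - 1) < w ! j)"

definition locally_minimal_at :: "'a::linorder list \<Rightarrow> nat \<Rightarrow> bool" where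
  "locally_minimal_at w i \<longleftrightarrow> non_decreasing_at w i \<and> i \<ge> 1 \<and> w ! (i - 1) > w ! i"

definition local_minima :: "'a::linorder list \<Rightarrow> nat list" where
  "local_minima w = sorted_list_of_set {i. locally_minimal_at w i}"

text \<open>Consecutive unimodal factors overlap in one letter, and the last one ends with the sentinel.\<close>

definition eis :: "'a::linorder list \<Rightarrow> 'a option list list" where
  "eis w = map2 (\<lambda>i j. map (letter w) [i..<Suc j])
     (local_minima w) (tl (local_minima w) @ [length w])"

text \<open>Factors are compared in the lexicographic order of \<^theory>\<open>HOL-Library.List_Lexorder\<close>.\<close>

definition is_word :: "'a::linorder list \<Rightarrow> nat list" where
  "is_word w = map (\<lambda>u. card {v \<in> set (eis w). v < u}) (eis w)"

end

theory Submission
  imports Defs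
begin

text \<open>
  If ties between equal letters were broken at random, each strict local minimum plateau of a word
  would contain at least one local minimum of the tie-broken sequence, and by exchangeability of
  three independent letters an inner position is such a minimum with probability exactly
  \<open>1/3\<close>. Averaging over the tie-breaking gives a function of three consecutive letters, whose sum
  along the word bounds the number of local minima from above and whose expectation is \<open>1/3\<close>.
  The bound on \<open>\<gamma>\<^sub>1\<close> follows from Markov's inequality.
\<close>

subsection \<open>Local minima of a word\<close>

lemma locally_minimal_at_less_length:
  assumes "locally_minimal_at w i"
  shows "i < length w"
proof -
  from assms obtain j where "i + 1 \<le> j" "j < length w"
    unfolding locally_minimal_at_def non_decreasing_at_def by blast
  then show ?thesis by simp
qed

lemma finite_locally_minimal: "finite {i. locally_minimal_at w i}"
  by (rule finite_subset[of _ "{..<length w}"]) (auto dest: locally_minimal_at_less_length)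

lemma length_is_word_le: "length (is_word w) \<le> card {i. locally_minimal_at w i}"
  by (simp add: is_word_def eis_def local_minima_def)

lemma non_decreasing_at_Cons_Suc:
  "non_decreasing_at (x # w) (Suc i) \<longleftrightarrow> non_decreasing_at w i" (is "?L \<longleftrightarrow> ?R")
proof
  assume ?L
  then obtain j where j: "Suc i + 1 \<le> j" "j < length (x # w)"
    "\<forall>m\<in>{Suc i..<j}. (x # w) ! m = (x # w) ! Suc i" "(x # w) ! (j - 1) < (x # w) ! j"
    unfolding non_decreasing_at_def by blast
  from j(1) obtain k where k: "j = Suc (Suc k)" "i \<le> k"
    by (metis Suc_eq_plus1 Suc_le_D Suc_le_mono)
  show ?R
    unfolding non_decreasing_at_def
  proof (intro exI[of _ "Suc k"] conjI ballI)
    fix m assume "m \<in> {i..<Suc k}"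
    then have "Suc m \<in> {Suc i..<j}" using k by auto
    with j(3) have "(x # w) ! Suc m = (x # w) ! Suc i" by blast
    then show "w ! m = w ! i" by simp
  qed (use j(1,2,4) k in auto)
next
  assume ?R
  then obtain j where j: "i + 1 \<le> j" "j < length w"
    "\<forall>m\<in>{i..<j}. w ! m = w ! i" "w ! (j - 1) < w ! j"
    unfolding non_decreasing_at_def by blast
  show ?L
    unfolding non_decreasing_at_def
  proof (intro exI[of _ "Suc j"] conjI ballI)
    fix m assume "m \<in> {Suc i..<Suc j}"
    then obtain k where k: "m = Suc k" "k \<in> {i..<j}" by (cases m) auto
    from j(3) k(2) have "w ! k = w ! i" by blast
    with k(1) show "(x # w) ! m = (x # w) ! Suc i" by (simp only: nth_Cons_Suc)
  next
    show "(x # w) ! (Suc j - 1) < (x # w) ! Suc j"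
      using j(1,4) by (cases j) auto
  qed (use j(1,2) in auto)
qed

text \<open>Together with the shift rule above, this makes \<open>non_decreasing_at\<close>
  recursive along the list, so that minima can be counted by induction on the word.\<close>

lemma non_decreasing_at_Cons_Cons_0:
  "non_decreasing_at (x # y # w) 0 \<longleftrightarrow> x < y \<or> x = y \<and> non_decreasing_at (y # w) 0"
  (is "?L \<longleftrightarrow> ?R")
proof
  assume ?L
  then obtain j where j: "1 \<le> j" "j < length (x # y # w)"
    "\<forall>m\<in>{0..<j}. (x # y # w) ! m = x" "(x # y # w) ! (j - 1) < (x # y # w) ! j"
    unfolding non_decreasing_at_def by auto
  show ?R
  proof (cases "j = 1")
    case True
    with j show ?thesis by simp
  next
    case False
    with j(1) have "1 \<in> {0..<j}" by auto
    with j(3) have xy: "x = y" by fastforce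
    \<comment> \<open>The plateau at \<open>0\<close> reaches position \<open>1\<close>, so the same
      witness \<open>j\<close> serves there.\<close>
    have "non_decreasing_at (x # y # w) (Suc 0)"
      unfolding non_decreasing_at_def
    proof (intro exI[of _ j] conjI)
      show "\<forall>m\<in>{Suc 0..<j}. (x # y # w) ! m = (x # y # w) ! Suc 0"
        using j(3) xy by (metis atLeastLessThan_iff le0 nth_Cons_0 nth_Cons_Suc)
    qed (use j(1,2,4) False in auto)
    with xy show ?thesis by (simp add: non_decreasing_at_Cons_Suc)
  qed
next
  assume ?R
  then show ?L
  proof
    assume "x < y"
    then show ?L unfolding non_decreasing_at_def by (intro exI[of _ 1]) auto
  next
    assume xy: "x = y \<and> non_decreasing_at (y # w) 0"
    then obtain j where j: "1 \<le> j" "j < length (y # w)"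
      "\<forall>m\<in>{0..<j}. (y # w) ! m = y" "(y # w) ! (j - 1) < (y # w) ! j"
      unfolding non_decreasing_at_def by auto
    show ?L
      unfolding non_decreasing_at_def
    proof (intro exI[of _ "Suc j"] conjI)
      show "\<forall>m\<in>{0..<Suc j}. (x # y # w) ! m = (x # y # w) ! 0"
      proof
        fix m assume "m \<in> {0..<Suc j}"
        with j(3) xy show "(x # y # w) ! m = (x # y # w) ! 0" by (cases m) auto
      qed
      show "(x # y # w) ! (Suc j - 1) < (x # y # w) ! Suc j"
        using j(1,4) by (cases j) auto
    qed (use j(1,2) in auto)
  qed
qed

lemma not_non_decreasing_at_singleton: "\<not> non_decreasing_at [x] 0"
  by (simp add: non_decreasing_at_def)

text \<open>The condition \<open>i \<ge> 1\<close> keeps the head of \<open>y # w\<close> from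
  counting. Once \<open>x\<close> stands before it, that letter can become a minimum; all later
  positions merely shift.\<close>

lemma card_locally_minimal_Cons:
  "card {i. locally_minimal_at (x # y # w) i} = card {i. locally_minimal_at (y # w) i} +
     (if y < x \<and> non_decreasing_at (y # w) 0 then 1 else 0)"
proof -
  have eq: "{i. locally_minimal_at (x # y # w) i} = Suc ` {i. locally_minimal_at (y # w) i} \<union>
    (if y < x \<and> non_decreasing_at (y # w) 0 then {1} else {})" (is "?A = ?B")
  proof (rule set_eqI)
    fix i show "i \<in> ?A \<longleftrightarrow> i \<in> ?B"
      \<comment> \<open>The cases are \<open>i = 0\<close>, \<open>i = 1\<close> and
        \<open>i \<ge> 2\<close>: never minimal, the new candidate, and the shifted minima.\<close>
      by (cases i; cases "i - 1")
         (auto simp: locally_minimal_at_def non_decreasing_at_Cons_Suc image_iff)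
  qed
  have "1 \<notin> Suc ` {i. locally_minimal_at (y # w) i}"
    by (auto simp: locally_minimal_at_def)
  then show ?thesis
    unfolding eq by (simp add: card_image finite_locally_minimal)
qed

text \<open>The probability that the middle letter is the minimum when ties are broken at random.\<close>

definition min_weight :: "'a::linorder \<Rightarrow> 'a \<Rightarrow> 'a \<Rightarrow> real" where
  "min_weight x y z =
     (if x < y \<or> z < y then 0 else if x = y \<and> y = z then 1 / 3
      else if x = y \<or> y = z then 1 / 2 else 1)"

lemma min_weight_nonneg: "0 \<le> min_weight x y z"
  by (simp add: min_weight_def)

text \<open>However ties are broken, exactly one of three letters is the least, and the three terms
  put each letter in the middle once.\<close>

lemma min_weight_cyclic_sum: "min_weight x y z + min_weight y z x + min_weight z x y = 1"
  by (auto simp: min_weight_def)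

fun sum_min_weight :: "'a::linorder list \<Rightarrow> real" where
  "sum_min_weight (x # y # z # w) = min_weight x y z + sum_min_weight (y # z # w)"
| "sum_min_weight _ = 0"

lemma sum_min_weight_nonneg: "0 \<le> sum_min_weight w"
  by (induction w rule: sum_min_weight.induct) (auto simp: min_weight_nonneg)

text \<open>The extra \<open>1/2\<close> pays for the second half of an initial plateau, whose first letter is not
  the middle of any triple: the other half comes from the letter to be prepended.\<close>

lemma card_locally_minimal_le_aux:
  "real (card {i. locally_minimal_at w i}) +
     (case w of x # y # _ \<Rightarrow> if x = y \<and> non_decreasing_at w 0 then 1 / 2 else 0 | _ \<Rightarrow> 0)
   \<le> sum_min_weight w"
proof (induction w rule: sum_min_weight.induct)
  \<comment> \<open>A new minimum at \<open>y\<close> costs 1: the weight is 1 if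
    \<open>y < z\<close>, while if \<open>y = z\<close> the weight 1/2 joins the 1/2 granted by the
    induction hypothesis. If \<open>x = y\<close>, the extra 1/2 is the weight itself when
    \<open>y < z\<close>, and is inherited when \<open>y = z\<close>.\<close>
  case (1 x y z w)
  then show ?case
    by (auto simp: card_locally_minimal_Cons[of x] non_decreasing_at_Cons_Cons_0 min_weight_def
        split: if_splits)
next
  case "2_1"
  then show ?case by (simp add: locally_minimal_at_def non_decreasing_at_def)
next
  case ("2_2" x)
  then show ?case by (auto simp: locally_minimal_at_def non_decreasing_at_def)
next
  case ("2_3" x y)
  have "{i. locally_minimal_at [y] i} = {}"
    by (auto simp: locally_minimal_at_def non_decreasing_at_def)
  then show ?case
    by (simp add: card_locally_minimal_Cons non_decreasing_at_Cons_Cons_0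
        not_non_decreasing_at_singleton)
qed

lemma length_is_word_le_sum_min_weight: "real (length (is_word w)) \<le> sum_min_weight w"
proof -
  have "real (length (is_word w)) \<le> real (card {i. locally_minimal_at w i})"
    using length_is_word_le[of w] by simp
  also have "\<dots> \<le> sum_min_weight w"
    using card_locally_minimal_le_aux[of w] by (auto split: list.splits if_splits)
  finally show ?thesis .
qed

subsection \<open>Expected number of local minima\<close>

text \<open>Tonelli for discrete laws: both sides integrate over two independent draws, whose order
  is irrelevant by \<open>bind_commute_pmf\<close>.\<close>

lemma nn_integral_pmf_swap:
  fixes p :: "'a pmf" and q :: "'b pmf"
  shows "(\<integral>\<^sup>+x. \<integral>\<^sup>+y. f x y \<partial>q \<partial>p) = (\<integral>\<^sup>+y. \<integral>\<^sup>+x. f x y \<partial>p \<partial>q)"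
proof -
  have "(\<integral>\<^sup>+x. \<integral>\<^sup>+y. f x y \<partial>q \<partial>p) =
    (\<integral>\<^sup>+s. case_prod f s \<partial>bind_pmf p (\<lambda>x. bind_pmf q (\<lambda>y. return_pmf (x, y))))"
    by (simp add: nn_integral_bind_pmf)
  also have "\<dots> =
    (\<integral>\<^sup>+s. case_prod f s \<partial>bind_pmf q (\<lambda>y. bind_pmf p (\<lambda>x. return_pmf (x, y))))"
    by (subst bind_commute_pmf) simp
  also have "\<dots> = (\<integral>\<^sup>+y. \<integral>\<^sup>+x. f x y \<partial>p \<partial>q)"
    by (simp add: nn_integral_bind_pmf)
  finally show ?thesis .
qed

lemma nn_integral_replicate_pmf_Suc:
  "(\<integral>\<^sup>+w. f w \<partial>replicate_pmf (Suc n) X) = (\<integral>\<^sup>+x. \<integral>\<^sup>+w. f (x # w) \<partial>replicate_pmf n X \<partial>X)"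
  by (simp add: nn_integral_bind_pmf)

text \<open>Three independent letters with the same law are exchangeable, so the three cyclic terms
  have equal integrals, and these add up to 1.\<close>

lemma nn_integral_min_weight:
  fixes X :: "'a::linorder pmf"
  shows "(\<integral>\<^sup>+x. \<integral>\<^sup>+y. \<integral>\<^sup>+z. ennreal (min_weight x y z) \<partial>X \<partial>X \<partial>X) = ennreal (1 / 3)"
  (is "?I = _")
proof -
  let ?f = "\<lambda>x y z. ennreal (min_weight x y z)"
  have swap1: "(\<integral>\<^sup>+x. \<integral>\<^sup>+y. \<integral>\<^sup>+z. ?f y z x \<partial>X \<partial>X \<partial>X) = ?I"
  proof -
    have "(\<integral>\<^sup>+x. \<integral>\<^sup>+y. \<integral>\<^sup>+z. ?f y z x \<partial>X \<partial>X \<partial>X) = (\<integral>\<^sup>+y. \<integral>\<^sup>+x. \<integral>\<^sup>+z. ?f y z x \<partial>X \<partial>X \<partial>X)"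
      by (rule nn_integral_pmf_swap)
    also have "\<dots> = ?I"
      by (intro nn_integral_cong nn_integral_pmf_swap)
    finally show ?thesis .
  qed
  have swap2: "(\<integral>\<^sup>+x. \<integral>\<^sup>+y. \<integral>\<^sup>+z. ?f z x y \<partial>X \<partial>X \<partial>X) = ?I"
  proof -
    have "(\<integral>\<^sup>+x. \<integral>\<^sup>+y. \<integral>\<^sup>+z. ?f z x y \<partial>X \<partial>X \<partial>X) = (\<integral>\<^sup>+x. \<integral>\<^sup>+z. \<integral>\<^sup>+y. ?f z x y \<partial>X \<partial>X \<partial>X)"
      by (intro nn_integral_cong nn_integral_pmf_swap)
    also have "\<dots> = ?I"
      by (rule nn_integral_pmf_swap)
    finally show ?thesis .
  qed
  have "1 = (\<integral>\<^sup>+x. \<integral>\<^sup>+y. \<integral>\<^sup>+z. ?f x y z + ?f y z x + ?f z x y \<partial>X \<partial>X \<partial>X)"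
    by (simp add: min_weight_cyclic_sum min_weight_nonneg flip: ennreal_plus)
  also have "\<dots> = ?I + ?I + ?I"
    by (simp add: nn_integral_add swap1 swap2)
  finally have sum: "?I + ?I + ?I = 1" by simp
  \<comment> \<open>Finiteness allows passing to a real \<open>r\<close> with
    \<open>3 * r = 1\<close>.\<close>
  then have "?I \<noteq> \<top>" by auto
  then obtain r where r: "?I = ennreal r" "0 \<le> r"
    by (cases ?I rule: ennreal_cases) auto
  have "ennreal (r + r + r) = ennreal r + ennreal r + ennreal r"
    using r(2) by (simp only: ennreal_plus add_nonneg_nonneg)
  also have "\<dots> = ennreal 1" using sum unfolding r(1) by simp
  finally have "ennreal (r + r + r) = ennreal 1" .
  with r(2) have "r = 1 / 3" by (subst (asm) ennreal_inj) auto
  with r show ?thesis by simp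
qed

text \<open>By linearity, each of the \<open>n - 2\<close> inner positions contributes 1/3.
  Truncated subtraction gives 0 for words too short to contain a triple.\<close>

lemma nn_integral_sum_min_weight:
  "(\<integral>\<^sup>+w. ennreal (sum_min_weight w) \<partial>replicate_pmf n X) = ennreal (real (n - 2) / 3)"
proof (induction n)
  case 0
  then show ?case by simp
next
  case (Suc n)
  consider "n = 0" | "n = 1" | k where "n = Suc (Suc k)"
    by (metis One_nat_def not0_implies_Suc)
  then show ?case
  proof cases
    case 1
    then show ?thesis by (simp add: nn_integral_bind_pmf)
  next
    case 2
    then show ?thesis by (simp add: nn_integral_bind_pmf)
  next
    case 3
    \<comment> \<open>Drawing three letters explicitly exposes the first triple. The remaining sum
      does not involve \<open>x\<close>, so integrating over \<open>x\<close> leaves the induction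
      hypothesis.\<close>
    have "(\<integral>\<^sup>+w. ennreal (sum_min_weight w) \<partial>replicate_pmf (Suc n) X) =
      (\<integral>\<^sup>+x. \<integral>\<^sup>+y. \<integral>\<^sup>+z. \<integral>\<^sup>+w. ennreal (min_weight x y z) + ennreal (sum_min_weight (y # z # w))
         \<partial>replicate_pmf k X \<partial>X \<partial>X \<partial>X)"
      unfolding 3 nn_integral_replicate_pmf_Suc
      by (simp add: min_weight_nonneg sum_min_weight_nonneg)
    also have "\<dots> = (\<integral>\<^sup>+x. \<integral>\<^sup>+y. \<integral>\<^sup>+z. ennreal (min_weight x y z) \<partial>X \<partial>X \<partial>X) +
      (\<integral>\<^sup>+y. \<integral>\<^sup>+z. \<integral>\<^sup>+w. ennreal (sum_min_weight (y # z # w)) \<partial>replicate_pmf k X \<partial>X \<partial>X)"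
      by (simp add: nn_integral_add)
    also have "(\<integral>\<^sup>+y. \<integral>\<^sup>+z. \<integral>\<^sup>+w. ennreal (sum_min_weight (y # z # w)) \<partial>replicate_pmf k X \<partial>X \<partial>X) =
      (\<integral>\<^sup>+w. ennreal (sum_min_weight w) \<partial>replicate_pmf n X)"
      unfolding 3 nn_integral_replicate_pmf_Suc ..
    also have "\<dots> = ennreal (real (n - 2) / 3)" by (rule Suc)
    finally show ?thesis
      using 3 by (simp add: nn_integral_min_weight field_simps flip: ennreal_plus)
  qed
qed

section \<open>From the mean to the constant \<open>\<gamma>\<^sub>1\<close>\<close>

lemma nn_integral_length_is_word_le:
  "(\<integral>\<^sup>+w. ennreal (real (length (is_word w))) \<partial>replicate_pmf n X) \<le> ennreal (real n / 3)"
proof -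
  have "(\<integral>\<^sup>+w. ennreal (real (length (is_word w))) \<partial>replicate_pmf n X)
    \<le> (\<integral>\<^sup>+w. ennreal (sum_min_weight w) \<partial>replicate_pmf n X)"
    by (intro nn_integral_mono ennreal_leI length_is_word_le_sum_min_weight)
  also have "\<dots> = ennreal (real (n - 2) / 3)" by (rule nn_integral_sum_min_weight)
  also have "\<dots> \<le> ennreal (real n / 3)" by (intro ennreal_leI) simp
  finally show ?thesis .
qed

text \<open>Markov's inequality, multiplied out so that \<open>t = 0\<close> is no special
  case.\<close>

lemma prob_length_is_word_ge:
  assumes "0 \<le> t"
  shows "t * measure_pmf.prob (replicate_pmf n X) {w. t \<le> real (length (is_word w))} \<le> real n / 3"
proof -
  let ?S = "{w. t \<le> real (length (is_word w))}"
  have "ennreal (t * measure_pmf.prob (replicate_pmf n X) ?S) =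
    (\<integral>\<^sup>+w. ennreal t * indicator ?S w \<partial>replicate_pmf n X)"
    using assms
    by (simp add: nn_integral_cmult_indicator ennreal_mult measure_pmf.emeasure_eq_measure)
  also have "\<dots> \<le> (\<integral>\<^sup>+w. ennreal (real (length (is_word w))) \<partial>replicate_pmf n X)"
    by (intro nn_integral_mono) (auto simp: indicator_def intro: ennreal_leI)
  also have "\<dots> \<le> ennreal (real n / 3)" by (rule nn_integral_length_is_word_le)
  finally show ?thesis by (subst (asm) ennreal_le_iff) auto
qed

theorem theorem18:
  fixes X :: "'a::{countable,linorder} pmf" and \<gamma>\<^sub>1 :: real
  assumes "\<exists>\<epsilon> :: nat \<Rightarrow> real. \<epsilon> \<longlonglongrightarrow> 0 \<and>
    (\<forall>n\<ge>1. measure_pmf.prob (replicate_pmf n X)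
       {w. \<bar>real (length (is_word w)) / real (length w) - \<gamma>\<^sub>1\<bar> \<ge> \<epsilon> (length w)} \<le> \<epsilon> n)"
  shows "\<gamma>\<^sub>1 \<le> 1 / 3"
proof (rule ccontr)
  assume "\<not> \<gamma>\<^sub>1 \<le> 1 / 3"
  then have \<gamma>: "1 / 3 < \<gamma>\<^sub>1" by simp
  obtain \<epsilon> :: "nat \<Rightarrow> real" where \<epsilon>: "\<epsilon> \<longlonglongrightarrow> 0"
    and conc: "\<And>n. n \<ge> 1 \<Longrightarrow> measure_pmf.prob (replicate_pmf n X)
       {w. \<bar>real (length (is_word w)) / real (length w) - \<gamma>\<^sub>1\<bar> \<ge> \<epsilon> (length w)} \<le> \<epsilon> n"
    using assms by blast
  \<comment> \<open>Outside the exceptional event the length is at least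
    \<open>(\<gamma>\<^sub>1 - \<epsilon> n) * n\<close>; Markov's inequality is applied at this
    threshold.\<close>
  have bound: "(\<gamma>\<^sub>1 - \<epsilon> n) * (1 - \<epsilon> n) \<le> 1 / 3" if n: "n \<ge> 1" and pos: "0 \<le> \<gamma>\<^sub>1 - \<epsilon> n" for n
  proof -
    let ?P = "measure_pmf.prob (replicate_pmf n X)"
    let ?B = "{w. \<bar>real (length (is_word w)) / real (length w) - \<gamma>\<^sub>1\<bar> \<ge> \<epsilon> (length w)}"
    let ?S = "{w. (\<gamma>\<^sub>1 - \<epsilon> n) * real n \<le> real (length (is_word w))}"
    have "1 - \<epsilon> n \<le> 1 - ?P ?B" using conc[OF n] by simp
    also have "\<dots> = ?P (- ?B)"
      using measure_pmf.prob_compl[of ?B "replicate_pmf n X"] by (simp add: Compl_eq_Diff_UNIV)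
    also have "\<dots> \<le> ?P ?S"
    proof (rule measure_pmf.finite_measure_mono_AE)
      show "AE w in replicate_pmf n X. w \<in> - ?B \<longrightarrow> w \<in> ?S"
      proof (subst AE_measure_pmf_iff, intro ballI impI)
        fix w assume "w \<in> set_pmf (replicate_pmf n X)" and w: "w \<in> - ?B"
        \<comment> \<open>Membership in the support turns \<open>\<epsilon> (length w)\<close> into
          \<open>\<epsilon> n\<close>.\<close>
        then have "length w = n" by (auto simp: set_replicate_pmf)
        with w have "\<gamma>\<^sub>1 - \<epsilon> n \<le> real (length (is_word w)) / real n" by auto
        with n show "w \<in> ?S" by (simp add: field_simps)
      qed
    qed simp
    finally have "(\<gamma>\<^sub>1 - \<epsilon> n) * real n * (1 - \<epsilon> n) \<le> (\<gamma>\<^sub>1 - \<epsilon> n) * real n * ?P ?S"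
      using pos by (intro mult_left_mono) auto
    also have "\<dots> \<le> real n / 3" using pos by (intro prob_length_is_word_ge) simp
    finally have "real n * ((\<gamma>\<^sub>1 - \<epsilon> n) * (1 - \<epsilon> n)) \<le> real n * (1 / 3)"
      by (simp add: algebra_simps)
    with n show ?thesis by (subst (asm) mult_le_cancel_left_pos) auto
  qed
  have lim: "(\<lambda>n. (\<gamma>\<^sub>1 - \<epsilon> n) * (1 - \<epsilon> n)) \<longlonglongrightarrow> (\<gamma>\<^sub>1 - 0) * (1 - 0)"
    by (intro tendsto_intros \<epsilon>)
  \<comment> \<open>The assumption \<open>1 / 3 < \<gamma>\<^sub>1\<close> makes
    \<open>\<gamma>\<^sub>1\<close> positive, so the threshold is eventually nonnegative and
    \<open>bound\<close> applies; in the limit it contradicts the same assumption.\<close>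
  have "eventually (\<lambda>n. \<epsilon> n < \<gamma>\<^sub>1) sequentially"
    using \<epsilon> \<gamma> by (intro order_tendstoD(2)[OF \<epsilon>]) simp
  then have "eventually (\<lambda>n. (\<gamma>\<^sub>1 - \<epsilon> n) * (1 - \<epsilon> n) \<le> 1 / 3) sequentially"
    using eventually_ge_at_top[of 1] by eventually_elim (rule bound, auto)
  from tendsto_upperbound[OF lim this] \<gamma> show False by simp
qed

end
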